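(* Fix a real number $q<0$ and define $c_q:=\min\{1,2^{1+1/q}\}$. Then $$ \mathsf{d}_{\star}(A+A)\ge c_q\,\mathscr{M}_q\bigl(\mathsf{d}(A),\mathsf{d}^{\star}(A+A)\bigr) $$ for all sets $A\subseteq\mathbb{N}$ which admit asymptotic density and satisfy $\mathsf{d}(A)>0$.
   Context: Here $\mathbb{N}=\{0,1,2,\ldots\}$. For $A\subseteq\mathbb{N}$, the lower and upper asymptotic densities are $$\mathsf{d}_{\star}(A)=\liminf_{N\to\infty}\frac{|A\cap[0,N)|}{N},\qquad \mathsf{d}^{\star}(A)=\limsup_{N\to\infty}\frac{|A\cap[0,N)|}{N}.$$ If $\mathsf{d}_{\star}(A)=\mathsf{d}^{\star}(A)$, then $A$ is said to admit asymptotic density, and the common value is denoted by $\mathsf{d}(A)$. The sumset is $A+A=\{x+y: x\in A,\ y\in A\}$. For reals $x,y>0$ and real $q\neq 0$, the $q$-mean is $$\mathscr{M}_q(x,y)=\left(\frac{x^q+y^q}{2}\right)^{1/q}.$$ *)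

theory Defs
  imports Complex_Main "HOL-Library.Liminf_Limsup" "HOL-Library.Extended_Real" "HOL-Library.Set_Algebras"
begin

text \<open>The sumset is the sum of sets from \<^theory>\<open>HOL-Library.Set_Algebras\<close>.\<close>

(* The term at N = 0 is 0 / 0 = 0; it does not affect the densities. *)
definition initial_ratio :: "nat set \<Rightarrow> nat \<Rightarrow> real" where
  "initial_ratio A N = real (card (A \<inter> {0..<N})) / real N"

(* The liminf and limsup are taken in the complete lattice of extended reals.
   They lie in [0, 1], so passing back to the reals loses nothing:
   see ereal_lower_density and ereal_upper_density below. *)
definition lower_density :: "nat set \<Rightarrow> real" where
  "lower_density A = real_of_ereal (liminf (\<lambda>N. ereal (initial_ratio A N)))"

definition upper_density :: "nat set \<Rightarrow> real" where
  "upper_density A = real_of_ereal (limsup (\<lambda>N. ereal (initial_ratio A N)))"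

definition admits_density :: "nat set \<Rightarrow> bool" where
  "admits_density A \<longleftrightarrow> lower_density A = upper_density A"

(* Only meaningful for sets with admits_density A, where it is the common value. *)
definition asymptotic_density :: "nat set \<Rightarrow> real" where
  "asymptotic_density A = lower_density A"

(* Intended for x, y > 0 and q \<noteq> 0. *)
definition q_mean :: "real \<Rightarrow> real \<Rightarrow> real \<Rightarrow> real" where
  "q_mean q x y = ((x powr q + y powr q) / 2) powr (1 / q)"

definition c_const :: "real \<Rightarrow> real" where
  "c_const q = min 1 (2 powr (1 + 1 / q))"

lemma initial_ratio_bounds: "0 \<le> initial_ratio A N" "initial_ratio A N \<le> 1"
proof -
  have "card (A \<inter> {0..<N}) \<le> N"
    using card_mono[of "{0..<N}" "A \<inter> {0..<N}"] by simp
  then show "0 \<le> initial_ratio A N" "initial_ratio A N \<le> 1"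
    by (auto simp: initial_ratio_def divide_le_eq)
qed

lemma ereal_lower_density:
  "ereal (lower_density A) = liminf (\<lambda>N. ereal (initial_ratio A N))"
proof -
  let ?l = "liminf (\<lambda>N. ereal (initial_ratio A N))"
  have "0 \<le> ?l"
    by (rule Liminf_bounded) (simp add: initial_ratio_bounds)
  moreover have "?l \<le> 1"
    by (rule order_trans[OF Liminf_le_Limsup Limsup_bounded])
       (simp_all add: initial_ratio_bounds)
  ultimately show ?thesis
    unfolding lower_density_def by (cases ?l) auto
qed

lemma ereal_upper_density:
  "ereal (upper_density A) = limsup (\<lambda>N. ereal (initial_ratio A N))"
proof -
  let ?l = "limsup (\<lambda>N. ereal (initial_ratio A N))"
  have "?l \<le> 1"
    by (rule Limsup_bounded) (simp add: initial_ratio_bounds)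
  moreover have "0 \<le> ?l"
    by (rule order_trans[OF Liminf_bounded Liminf_le_Limsup])
       (simp_all add: initial_ratio_bounds)
  ultimately show ?thesis
    unfolding upper_density_def by (cases ?l) auto
qed

end

theory Submission
  imports Defs "HOL-Analysis.Convex"
begin

text \<open>
  Write \<open>C = A + A\<close>, \<open>a\<close> for the density of \<open>A\<close>, and \<open>l\<close>, \<open>u\<close> for the lower and upper density of \<open>C\<close>.
  Power means reduce the claim to its case \<open>q = -1\<close>, the bound \<open>l \<ge> 2au/(a+u)\<close>.
  This is weaker than the consequence \<open>l \<ge> min(2a, u)\<close> of Kneser's theorem, and it does not need that theorem.

  Up to errors that vanish in the limit: choose \<open>M\<close> at which the surplus of \<open>C\<close> over density \<open>u\<close> sets a
  record, and put \<open>F = A \<inter> [0,M)\<close>, \<open>X = A \<inter> [0,n)\<close> with \<open>n\<close> much larger than \<open>M\<close>, and \<open>t = u/a\<close>.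
  Applying Pluennecke's inequality repeatedly to the part of \<open>X\<close> with the smallest growth gives \<open>P \<subseteq> X\<close> with
  \<open>(1+t)|P+F| \<ge> t|P| + |P+F+F|\<close> and \<open>|(X+F)-(P+F)| \<ge> t|X-P|\<close>.
  Let \<open>H = P + [0,M)\<close>. The choice of \<open>M\<close> gives \<open>|P+F+F| \<ge> u|H|\<close>. As in Schnirelmann's inequality, each gap of \<open>H\<close>
  is filled with density \<open>a\<close> by a translate \<open>p + A\<close> of \<open>A\<close>, where \<open>p\<close> is the last element of \<open>P\<close> before it.
  So \<open>Y = |(C \<inter> [0,n)) - (P+F)|\<close> is at least \<open>t|X-P|\<close> and at least \<open>a(n-|H|)\<close>.
  Adding \<open>(1+t)|P+F| \<ge> t|P| + u|H|\<close> and \<open>(1+t)Y \<ge> t|X-P| + u(n-|H|)\<close> yields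
  \<open>(1+t)|C \<inter> [0,n)| \<ge> t|X| + un\<close>, which is about \<open>2un\<close>.
\<close>

section \<open>Inequalities of Pluennecke type\<close>

text \<open>Petridis' proof of Pluennecke's inequality, relative to the sumsets of \<open>P\<close>. The sets \<open>P + F\<close> and \<open>P + F + F\<close>
  that are removed stay fixed while \<open>S\<close> grows; removing \<open>P + S\<close> and \<open>P + F + S\<close> would break the induction.\<close>

lemma marginal_sumset_bound:
  fixes Z P F S :: "'a::cancel_ab_semigroup_add set" and K :: real
  assumes fin: "finite Z" "finite P" "finite F"
    and SF: "S \<subseteq> F" and K: "K \<ge> 0"
    and min: "\<And>W. W \<subseteq> Z \<Longrightarrow> K * card W \<le> card ((W + F) - (P + F))"
    and eq: "card ((Z + F) - (P + F)) \<le> K * card Z"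
  shows "card ((Z + F + S) - (P + F + F)) \<le> K * card ((Z + S) - (P + F))"
proof -
  have "finite S" using SF fin finite_subset by blast
  then show ?thesis using SF
  proof (induction S)
    case empty
    then show ?case by (simp add: set_plus_def)
  next
    case (insert s S)
    have fS: "finite S" and sF: "s \<in> F" using insert by auto
    \<comment> \<open>\<open>W\<close> collects the \<open>z\<close> for which all of
      \<open>s + z + F\<close> is already covered. New points of \<open>?A'\<close> come only from
      sums outside \<open>W + F\<close>, while each \<open>z\<close> outside \<open>W\<close> puts
      the new point \<open>s + z\<close> into \<open>?B'\<close>.\<close>
    define W where "W = {z \<in> Z. \<forall>f\<in>F. s + z + f \<in> (Z + F + S) \<union> (P + F + F)}"
    let ?A = "(Z + F + S) - (P + F + F)" and ?B = "(Z + S) - (P + F)"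
    let ?A' = "(Z + F + insert s S) - (P + F + F)" and ?B' = "(Z + insert s S) - (P + F)"
    let ?D = "((Z + F) - (P + F)) - ((W + F) - (P + F))"
    have WZ: "W \<subseteq> Z" by (auto simp: W_def)
    have finW: "finite W" using WZ fin finite_subset by blast
    have f1: "finite ?A" "finite ?D" "finite ?B" "finite ?B'"
      using fin fS by (auto intro!: finite_set_plus)
    have sub: "?A' \<subseteq> ?A \<union> (+) s ` ?D"
    proof
      fix x assume x: "x \<in> ?A'"
      show "x \<in> ?A \<union> (+) s ` ?D"
      proof (cases "x \<in> ?A")
        case False
        with x have nS: "x \<notin> Z + F + S" and nP: "x \<notin> P + F + F" by auto
        from x obtain y r where y: "x = y + r" "y \<in> Z + F" "r \<in> insert s S"
          by (auto elim!: set_plus_elim)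
        with nS have r: "r = s" by (auto intro: set_plus_intro)
        \<comment> \<open>Otherwise \<open>y + s\<close> would lie in the removed set
          \<open>P + F + F\<close>, because \<open>s\<close> is in \<open>F\<close>.\<close>
        have "y \<notin> P + F" using nP y r sF by (auto intro: set_plus_intro)
        moreover have "y \<notin> W + F"
        proof
          assume "y \<in> W + F"
          then obtain w f where "y = w + f" "w \<in> W" "f \<in> F" by (auto elim!: set_plus_elim)
          then have "x \<in> (Z + F + S) \<union> (P + F + F)"
            using y r by (auto simp: W_def ac_simps)
          with nS nP show False by auto
        qed
        ultimately show ?thesis using y r by (auto simp: add.commute)
      qed auto
    qed
    have "card ?A' \<le> card (?A \<union> (+) s ` ?D)"
      using sub f1 by (intro card_mono) auto
    also have "\<dots> \<le> card ?A + card ((+) s ` ?D)" by (rule card_Un_le)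
    also have "card ((+) s ` ?D) \<le> card ?D" using f1 card_image_le by blast
    finally have a: "card ?A' \<le> card ?A + card ?D" by simp
    have "(W + F) - (P + F) \<subseteq> (Z + F) - (P + F)"
      using WZ by (auto elim!: set_plus_elim intro: set_plus_intro)
    then have "real (card ?D) = real (card ((Z + F) - (P + F))) - card ((W + F) - (P + F))"
      using fin finW by (subst card_Diff_subset) (auto intro!: finite_set_plus card_mono of_nat_diff)
    also have "\<dots> \<le> K * card Z - K * card W" using eq min[OF WZ] by linarith
    finally have d: "real (card ?D) \<le> K * (real (card Z) - card W)" by (simp add: algebra_simps)
    have sub2: "?B \<union> (+) s ` (Z - W) \<subseteq> ?B'" and dis: "?B \<inter> (+) s ` (Z - W) = {}"
    proof -
      have n1: "s + z \<notin> P + F" and n2: "s + z \<notin> Z + S" if z: "z \<in> Z - W" for z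
      proof -
        from z obtain f where f: "f \<in> F" "s + z + f \<notin> Z + F + S" "s + z + f \<notin> P + F + F"
          by (auto simp: W_def)
        show "s + z \<notin> P + F" using f by (auto intro: set_plus_intro)
        show "s + z \<notin> Z + S"
        proof
          assume "s + z \<in> Z + S"
          then obtain z' s' where *: "s + z = z' + s'" "z' \<in> Z" "s' \<in> S"
            by (auto elim!: set_plus_elim)
          then have "s + z + f = (z' + f) + s'" by (simp add: ac_simps)
          with * f show False by (auto intro: set_plus_intro)
        qed
      qed
      have "s + z \<in> Z + insert s S" if "z \<in> Z" for z
        using set_plus_intro[OF that, of s "insert s S"] by (simp add: add.commute)
      moreover have "Z + S \<subseteq> Z + insert s S" by (rule set_plus_mono2) auto
      ultimately show "?B \<union> (+) s ` (Z - W) \<subseteq> ?B'"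
        using n1 by blast
      show "?B \<inter> (+) s ` (Z - W) = {}" using n2 by auto
    qed
    have "card ?B + card (Z - W) = card (?B \<union> (+) s ` (Z - W))"
      using f1 fin dis by (subst card_Un_disjoint) (auto simp: card_image)
    also have "\<dots> \<le> card ?B'" using sub2 f1 by (intro card_mono)
    finally have "real (card ?B) + (real (card Z) - card W) \<le> card ?B'"
      using WZ fin finW by (simp add: card_Diff_subset of_nat_diff card_mono)
    then have b: "K * card ?B + K * (real (card Z) - card W) \<le> K * card ?B'"
      using K by (metis distrib_left mult_left_mono)
    have "real (card ?A) \<le> K * card ?B" using insert by auto
    with a b d show ?case by linarith
  qed
qed

lemma card_union_sumset:
  fixes P Z F :: "'a::ab_semigroup_add set"
  assumes "finite P" "finite Z" "finite F"
  shows "card ((P \<union> Z) + F) = card (P + F) + card ((Z + F) - (P + F))"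
proof -
  have "(P \<union> Z) + F = (P + F) \<union> ((Z + F) - (P + F))"
    by (auto elim!: set_plus_elim intro: set_plus_intro)
  then show ?thesis using assms by (simp only:) (subst card_Un_disjoint; auto intro!: finite_set_plus)
qed

text \<open>A piece \<open>Z\<close> of least marginal growth \<open>K < t\<close> can be absorbed
  into \<open>P\<close>: by \<open>marginal_sumset_bound\<close> with \<open>S = F\<close> it adds
  at most \<open>K * K * card Z\<close> to the size of \<open>P + F + F\<close>. A maximal
  \<open>P\<close> leaves a rest of growth at least \<open>t\<close>.\<close>

lemma sumset_partition:
  fixes X F :: "'a::cancel_ab_semigroup_add set" and t :: real
  assumes fin: "finite X" "finite F" and F: "F \<noteq> {}"
  obtains P where "P \<subseteq> X"
    and "(1 + t) * card (P + F) \<ge> t * card P + card (P + F + F)"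
    and "card (((X - P) + F) - (P + F)) \<ge> t * card (X - P)"
proof -
  \<comment> \<open>The last clause, that subsets of the rest have marginal growth at least 1,
    provides \<open>K \<ge> 1\<close> for the next piece.\<close>
  define good where "good P \<longleftrightarrow> P \<subseteq> X \<and>
    (1 + t) * card (P + F) \<ge> t * card P + card (P + F + F) \<and>
    (\<forall>W \<subseteq> X - P. card ((W + F) - (P + F)) \<ge> card W)" for P
  have emp: "good {}"
  proof -
    obtain f where f: "f \<in> F" using F by auto
    have "card W \<le> card (W + F)" if "W \<subseteq> X" for W
    proof -
      have "finite W" using that fin finite_subset by blast
      have "card W = card ((+) f ` W)" by (simp add: card_image)
      also have "\<dots> \<le> card (W + F)"
        using fin \<open>finite W\<close> set_plus_intro[OF _ f, of _ W]
        by (intro card_mono finite_set_plus) (auto simp: add.commute)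
      finally show ?thesis .
    qed
    then show ?thesis by (simp add: good_def set_plus_def)
  qed
  have "finite {P. good P}"
    by (rule finite_subset[of _ "Pow X"]) (auto simp: good_def fin)
  then obtain P where P: "good P" and max: "\<And>Q. good Q \<Longrightarrow> P \<subseteq> Q \<Longrightarrow> Q = P"
    using finite_has_maximal[of "{P. good P}"] emp by auto
  have PX: "P \<subseteq> X" and finP: "finite P" using P fin finite_subset by (auto simp: good_def)
  define m where "m W = real (card ((W + F) - (P + F)))" for W
  have "t * card (X - P) \<le> m (X - P)"
  proof (rule ccontr)
    assume bad: "\<not> ?thesis"
    define \<Z> where "\<Z> = Pow (X - P) - {{}}"
    have "t * card ({} :: 'a set) \<le> m {}" by (simp add: m_def)
    then have "X - P \<noteq> {}" using bad by metis
    then have XP: "X - P \<in> \<Z>" by (simp add: \<Z>_def)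
    define Z where "Z = arg_min_on (\<lambda>W. m W / card W) \<Z>"
    have "finite \<Z>" using fin by (simp add: \<Z>_def)
    moreover have "\<Z> \<noteq> {}" using XP by auto
    ultimately have Z: "Z \<in> \<Z>"
      and mn: "\<And>W. W \<in> \<Z> \<Longrightarrow> m Z / card Z \<le> m W / card W"
      using arg_min_if_finite[of \<Z> "\<lambda>W. m W / card W"]
      unfolding Z_def[symmetric] by (simp, fastforce simp: not_less)
    define K where "K = m Z / card Z"
    have finZ: "finite Z" and ZX: "Z \<subseteq> X - P" "Z \<noteq> {}"
      using Z fin finite_subset by (auto simp: \<Z>_def)
    have cZ: "card Z > 0" using finZ ZX by (simp add: card_gt_0_iff)
    have mZ: "m Z = K * card Z" using cZ by (simp add: K_def)
    have mW: "K * card W \<le> m W" if "W \<subseteq> X - P" for W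
    proof (cases "W = {}")
      case False
      then have "W \<in> \<Z>" "card W > 0" using that fin finite_subset[of W "X - P"]
        by (auto simp: \<Z>_def card_gt_0_iff)
      then show ?thesis using mn[of W] by (simp add: K_def field_simps)
    qed (simp add: m_def)
    have K1: "K \<ge> 1"
    proof -
      have "real (card Z) \<le> m Z" using P ZX by (auto simp: good_def m_def)
      then show ?thesis using cZ by (simp add: K_def)
    qed
    have cXP: "card (X - P) > 0" using XP fin by (auto simp: \<Z>_def card_gt_0_iff)
    have Kt: "K < t"
    proof -
      have "K * card (X - P) < t * card (X - P)" using mW[of "X - P"] bad by auto
      then show ?thesis using cXP by simp
    qed
    have w: "card ((Z + F + F) - (P + F + F)) \<le> K * m Z"
      unfolding m_def
      by (rule marginal_sumset_bound) (use fin finP finZ ZX mW mZ K1 in \<open>auto simp: m_def\<close>)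
    have "good (P \<union> Z)"
      unfolding good_def
    proof (intro conjI allI impI)
      show "P \<union> Z \<subseteq> X" using PX ZX by auto
      have c1: "card ((P \<union> Z) + F) = card (P + F) + m Z"
        using card_union_sumset[OF finP finZ fin(2)] by (simp add: m_def)
      have un: "(P \<union> Z) + F = (P + F) \<union> (Z + F)"
        by (auto elim!: set_plus_elim intro: set_plus_intro)
      have c2: "real (card ((P \<union> Z) + F + F)) \<le> card (P + F + F) + K * m Z"
        using card_union_sumset[of "P + F" "Z + F" F] fin finP finZ w
        by (simp add: un finite_set_plus)
      have c3: "card (P \<union> Z) = card P + card Z"
        using finP finZ ZX by (intro card_Un_disjoint) auto
      \<comment> \<open>the growth \<open>K\<close> of the new part lies between the roots \<open>1\<close> and \<open>t\<close> of \<open>K\<^sup>2 - (1 + t) K + t\<close>\<close>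
      have "0 \<le> (K - 1) * (t - K) * card Z" using K1 Kt by simp
      then have "t * card Z + K * m Z \<le> (1 + t) * m Z" unfolding mZ by (simp add: algebra_simps)
      moreover have "t * card P + card (P + F + F) \<le> (1 + t) * card (P + F)"
        using P by (simp add: good_def)
      ultimately show "t * card (P \<union> Z) + card (P \<union> Z + F + F) \<le> (1 + t) * card (P \<union> Z + F)"
        unfolding c1 c3 using c2 by (simp add: algebra_simps)
      fix W assume W: "W \<subseteq> X - (P \<union> Z)"
      have finW: "finite W" using W fin finite_subset by blast
      \<comment> \<open>\<open>Z \<union> W\<close> has growth at least \<open>K\<close> by
        minimality and \<open>Z\<close> has exactly \<open>K\<close>, so \<open>W\<close> has growth
        at least \<open>K\<close> relative to \<open>P \<union> Z\<close>.\<close>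
      have "K * card W \<le> m (Z \<union> W) - m Z"
      proof -
        have "card (Z \<union> W) = card Z + card W"
          using finZ finW W by (intro card_Un_disjoint) auto
        then show ?thesis using mW[of "Z \<union> W"] W ZX mZ by (auto simp: algebra_simps)
      qed
      moreover have "card W \<le> K * card W" using K1 mult_right_mono[of 1 K "card W"] by simp
      moreover have "m (Z \<union> W) - m Z = card ((W + F) - (P \<union> Z + F))"
        using card_union_sumset[of "P \<union> Z" W F] card_union_sumset[of P "Z \<union> W" F]
          card_union_sumset[of P Z F] fin finP finZ finW by (simp add: m_def Un_assoc)
      ultimately show "card W \<le> card ((W + F) - (P \<union> Z + F))" by linarith
    qed
    with max[of "P \<union> Z"] ZX show False by auto
  qed
  with that[of P] P show thesis by (simp add: good_def m_def)
qed


section \<open>Counting inside and outside the intervals \<open>p + {0..<M}\<close>\<close>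

text \<open>Build \<open>P\<close> in increasing order. A new largest element \<open>b\<close>
  enlarges \<open>P + {0..<M}\<close> by at most the end of its interval that sticks out. The
  matching tail of \<open>b + D\<close> lies beyond all earlier sums, and \<open>tail\<close> bounds
  its size.\<close>

lemma right_tail_sumset:
  fixes P D :: "nat set" and u :: real
  assumes "finite P" and D: "D \<subseteq> {0..<M}" and u: "u \<ge> 0"
    and tail: "\<And>s. s \<le> M \<Longrightarrow> u * (M - s) \<le> card (D \<inter> {s..<M})"
  shows "u * card (P + {0..<M}) \<le> card (P + D)"
  using \<open>finite P\<close>
proof (induction P rule: finite_linorder_max_induct)
  case (insert b A)
  \<comment> \<open>\<open>b + s\<close> is where the interval at \<open>b\<close> leaves the one at
    \<open>Max A\<close>; truncated subtraction gives \<open>s = 0\<close> when the two are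
    disjoint.\<close>
  define s where "s = (if A = {} then 0 else Max A + M - b)"
  have Mx: "Max A \<in> A" "Max A < b" if "A \<noteq> {}" using insert that by auto
  have s: "s \<le> M" using Mx by (cases "A = {}") (auto simp: s_def)
  have finD: "finite D" using D finite_subset by blast
  have sub: "insert b A + {0..<M} \<subseteq> (A + {0..<M}) \<union> {b + s..<b + M}"
  proof
    fix x assume "x \<in> insert b A + {0..<M}"
    then obtain c i where x: "x = c + i" "c \<in> insert b A" "i < M"
      by (auto elim!: set_plus_elim)
    show "x \<in> (A + {0..<M}) \<union> {b + s..<b + M}"
    proof (cases "c \<in> A \<or> i \<ge> s")
      case True
      then show ?thesis using x by auto
    next
      case False
      then have "A \<noteq> {}" and c: "c = b" using x by (auto simp: s_def split: if_splits)
      then have "x - Max A < M" "x = Max A + (x - Max A)"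
        using False Mx x by (auto simp: s_def)
      then show ?thesis
        using set_plus_intro[of "Max A" A "x - Max A" "{0..<M}"] Mx[OF \<open>A \<noteq> {}\<close>] by auto
    qed
  qed
  have "card (insert b A + {0..<M}) \<le> card ((A + {0..<M}) \<union> {b + s..<b + M})"
    using sub insert by (intro card_mono) (auto intro: finite_set_plus)
  also have "\<dots> \<le> card (A + {0..<M}) + card {b + s..<b + M}" by (rule card_Un_le)
  finally have "card (insert b A + {0..<M}) \<le> card (A + {0..<M}) + (M - s)" by simp
  then have "u * card (insert b A + {0..<M}) \<le> u * (card (A + {0..<M}) + (M - s))"
    using u by (intro mult_left_mono) simp_all
  also have "\<dots> \<le> card (A + D) + card (D \<inter> {s..<M})"
    using insert.IH tail[OF s] s by (simp add: algebra_simps of_nat_diff)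
  also have "\<dots> = card (A + D) + card ((+) b ` (D \<inter> {s..<M}))"
    by (simp add: card_image)
  also have "\<dots> = card ((A + D) \<union> (+) b ` (D \<inter> {s..<M}))"
  proof -
    have "a + d \<noteq> b + d'" if "a \<in> A" "d \<in> D" "d' \<in> D \<inter> {s..<M}" for a d d'
    proof -
      have "a \<le> Max A" "A \<noteq> {}" using that insert by auto
      then show ?thesis using that D by (auto simp: s_def)
    qed
    then have "(A + D) \<inter> (+) b ` (D \<inter> {s..<M}) = {}" by (auto elim!: set_plus_elim)
    then show ?thesis using insert finD by (subst card_Un_disjoint) (auto intro: finite_set_plus)
  qed
  also have "\<dots> \<le> card (insert b A + D)"
  proof -
    have "(A + D) \<union> (+) b ` (D \<inter> {s..<M}) \<subseteq> insert b A + D"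
      using set_plus_mono2[of A "insert b A" D D] by auto
    then show ?thesis using insert finD by (simp add: card_mono finite_set_plus)
  qed
  finally show ?case by simp
qed simp

text \<open>Schnirelmann's gap argument, by strong induction on \<open>n\<close>. The error
  \<open>e * M\<close> of the gap after \<open>p + {0..<M}\<close> is charged to the
  \<open>M\<close> points of that interval, so all gaps together cost at most \<open>e * n\<close>.
  The constant \<open>c\<close> pays for the stretch before the first element of
  \<open>P\<close>.\<close>

lemma card_sumset_outside_intervals:
  fixes A P :: "nat set" and a e c :: real
  assumes PA: "P \<subseteq> A" and a: "a \<ge> 0" and e: "e \<ge> 0"
    and start: "\<And>n. a * n - c \<le> card ((A + A) \<inter> {0..<n})"
    and gap: "\<And>g. a * g - e * M \<le> card (A \<inter> {M..<M + g})"
  shows "a * card ({0..<n} - (P + {0..<M})) - e * n - c \<le> card ((A + A) \<inter> {0..<n} - (P + {0..<M}))"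
proof (induction n rule: less_induct)
  case (less n)
  let ?H = "P + {0..<M}"
  show ?case
  proof (cases n)
    case 0
    then show ?thesis using start[of 0] by simp
  next
    case (Suc m)
    show ?thesis
    proof (cases "m \<in> ?H")
      case True
      then have "{0..<n} - ?H = {0..<m} - ?H" "(A + A) \<inter> {0..<n} - ?H = (A + A) \<inter> {0..<m} - ?H"
        using Suc by (auto simp: less_Suc_eq)
      moreover have "e * m \<le> e * n" using e Suc by (intro mult_left_mono) auto
      ultimately show ?thesis using less.IH[of m] Suc by simp
    next
      case False
      show ?thesis
      proof (cases "P \<inter> {0..<n} = {}")
        case True
        then have "{0..<n} \<inter> ?H = {}" by (fastforce elim!: set_plus_elim)
        then have "{0..<n} - ?H = {0..<n}" "(A + A) \<inter> {0..<n} - ?H = (A + A) \<inter> {0..<n}" by auto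
        moreover have "0 \<le> e * n" using e by simp
        ultimately show ?thesis using start[of n] by simp
      next
        case ne: False
        define p where "p = Max (P \<inter> {0..<n})"
        have p: "p \<in> P" "p < n" and pmax: "\<And>p'. p' \<in> P \<Longrightarrow> p' < n \<Longrightarrow> p' \<le> p"
          using Max_in[OF _ ne] by (auto simp: p_def)
        \<comment> \<open>As \<open>m = n - 1\<close> is uncovered, the interval at \<open>p\<close>
          ends below \<open>m\<close>, and \<open>{p + M..<n}\<close> is a gap of
          \<open>?H\<close>.\<close>
        have "m = p + (m - p)" using p Suc by simp
        then have pM: "p + M \<le> m"
          using False set_plus_intro[of p P "m - p" "{0..<M}"] p(1) by (cases "m - p < M") auto
        define g where "g = n - (p + M)"
        have n: "n = p + M + g" using pM Suc by (simp add: g_def)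
        have inH: "p + i \<in> ?H" if "i < M" for i using p(1) that by auto
        have "{0..<n} - ?H \<subseteq> ({0..<p} - ?H) \<union> {p + M..<n}"
        proof
          fix x assume x: "x \<in> {0..<n} - ?H"
          have False if "p \<le> x" "x < p + M" using inH[of "x - p"] x that by auto
          then show "x \<in> ({0..<p} - ?H) \<union> {p + M..<n}" using x by fastforce
        qed
        then have "card ({0..<n} - ?H) \<le> card (({0..<p} - ?H) \<union> {p + M..<n})"
          by (intro card_mono) auto
        also have "\<dots> \<le> card ({0..<p} - ?H) + card {p + M..<n}" by (rule card_Un_le)
        finally have "card ({0..<n} - ?H) \<le> card ({0..<p} - ?H) + g" by (simp add: n)
        then have "a * card ({0..<n} - ?H) \<le> a * (card ({0..<p} - ?H) + g)"
          using a by (intro mult_left_mono) simp_all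
        moreover have "card ((A + A) \<inter> {0..<p} - ?H) + card (A \<inter> {M..<M + g})
            \<le> card ((A + A) \<inter> {0..<n} - ?H)"
        proof -
          let ?U = "(A + A) \<inter> {0..<p} - ?H" and ?V = "(+) p ` (A \<inter> {M..<M + g})"
          have "p + x \<notin> ?H" if "x \<in> {M..<M + g}" for x
          proof
            assume "p + x \<in> ?H"
            then obtain p' i where *: "p + x = p' + i" "p' \<in> P" "i < M"
              by (auto elim!: set_plus_elim)
            then have "p' \<le> p" using that n by (intro pmax) auto
            with * that show False by auto
          qed
          then have "?U \<union> ?V \<subseteq> (A + A) \<inter> {0..<n} - ?H" using n p(1) PA by auto
          then have "card (?U \<union> ?V) \<le> card ((A + A) \<inter> {0..<n} - ?H)" by (intro card_mono) auto
          moreover have "card (?U \<union> ?V) = card ?U + card (A \<inter> {M..<M + g})"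
            by (subst card_Un_disjoint) (auto simp: card_image)
          ultimately show ?thesis by simp
        qed
        moreover have "e * p + e * M \<le> e * n" using e mult_left_mono[of "real (p + M)" n e] n
          by (simp add: algebra_simps)
        ultimately show ?thesis using less.IH[OF p(2)] gap[of g] by (simp add: algebra_simps)
      qed
    qed
  qed
qed

section \<open>The finite counting inequality\<close>

text \<open>The weight \<open>u / a\<close> turns the gap density \<open>a\<close> into
  \<open>u\<close>, so the terms in \<open>card H\<close> cancel when the bounds for
  \<open>P + F\<close> and for the rest of \<open>A + A\<close> are added.\<close>

lemma card_sumset_lower_bound:
  fixes A :: "nat set" and a u e c :: real
  assumes a: "a > 0" and u: "u \<ge> 0" and e: "e \<ge> 0" and F: "A \<inter> {0..<M} \<noteq> {}"
    and lower: "\<And>n. a * n - c \<le> card (A \<inter> {0..<n})"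
    and start: "\<And>n. a * n - c \<le> card ((A + A) \<inter> {0..<n})"
    and gap: "\<And>g. a * g - e * M \<le> card (A \<inter> {M..<M + g})"
    and tail: "\<And>s. s \<le> M \<Longrightarrow> u * (M - s) \<le> card ((A + A) \<inter> {s..<M})"
    and n: "M \<le> n"
  shows "(1 + u / a) * card ((A + A) \<inter> {0..<n}) \<ge> 2 * u * n - u * M - u / a * (e * n + 2 * c)"
proof -
  define t where "t = u / a"
  have t: "t \<ge> 0" "t * a = u" using a u by (auto simp: t_def)
  define F where "F = A \<inter> {0..<M}"
  \<comment> \<open>Cutting at \<open>n - M\<close> keeps \<open>X + F\<close> and \<open>H\<close>
    below \<open>n\<close>; the price is the term \<open>u * M\<close>.\<close>
  define X where "X = A \<inter> {0..<n - M}"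
  let ?C = "(A + A) \<inter> {0..<n}"
  have fin: "finite F" "finite X" by (auto simp: F_def X_def)
  obtain P where P: "P \<subseteq> X" "(1 + t) * card (P + F) \<ge> t * card P + card (P + F + F)"
    "card (((X - P) + F) - (P + F)) \<ge> t * card (X - P)"
    using sumset_partition[of X F t] fin assms(4) unfolding F_def by blast
  have finP: "finite P" using P fin finite_subset by blast
  have PA: "P \<subseteq> A" using P by (auto simp: X_def)
  define H where "H = P + {0..<M}"
  have XF: "X + F \<subseteq> ?C" using n by (auto simp: X_def F_def elim!: set_plus_elim)
  have PF: "P + F \<subseteq> ?C" and RF: "(X - P) + F \<subseteq> ?C"
    using XF set_plus_mono2[of P X F F] set_plus_mono2[of "X - P" X F F] P by auto
  have PFH: "P + F \<subseteq> H" unfolding H_def F_def by (rule set_plus_mono2) auto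
  have Hn: "H \<subseteq> {0..<n}" using P n by (force simp: H_def X_def elim!: set_plus_elim)
  have hull: "u * card H \<le> card (P + F + F)"
  proof -
    let ?D = "(A + A) \<inter> {0..<M}"
    have "?D \<inter> {s..<M} = (A + A) \<inter> {s..<M}" for s by auto
    then have "u * card H \<le> card (P + ?D)"
      unfolding H_def using tail finP u by (intro right_tail_sumset) auto
    also have "?D \<subseteq> F + F" by (fastforce simp: F_def elim!: set_plus_elim)
    then have "P + ?D \<subseteq> P + F + F" by (simp add: add.assoc set_plus_mono2)
    then have "card (P + ?D) \<le> card (P + F + F)"
      using fin finP by (intro card_mono finite_set_plus)
    finally show ?thesis by simp
  qed
  define Y where "Y = real (card (?C - (P + F)))"
  have Y1: "t * card (X - P) \<le> Y"
  proof -
    have "card (((X - P) + F) - (P + F)) \<le> card (?C - (P + F))"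
      using RF by (intro card_mono) auto
    then show ?thesis using P(3) by (simp add: Y_def)
  qed
  have Y2: "a * (real n - card H) - e * n - c \<le> Y"
  proof -
    have "a * card ({0..<n} - H) - e * n - c \<le> card (?C - H)"
      unfolding H_def using a e start gap PA by (intro card_sumset_outside_intervals) auto
    also have "card (?C - H) \<le> card (?C - (P + F))" using PFH by (intro card_mono) auto
    finally show ?thesis using Hn card_mono[OF _ Hn]
      by (simp add: Y_def card_Diff_subset finite_subset of_nat_diff)
  qed
  have "real (card ?C) = card (P + F) + Y"
    using PF fin finP card_mono[OF _ PF]
    by (simp add: Y_def card_Diff_subset finite_set_plus of_nat_diff)
  \<comment> \<open>One copy of \<open>Y\<close> is bounded by \<open>Y1\<close>, the other
    \<open>t\<close> copies by \<open>Y2\<close>.\<close>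
  then have "(1 + t) * card ?C = (1 + t) * card (P + F) + Y + t * Y" by (simp add: algebra_simps)
  moreover have "t * Y \<ge> t * (a * (real n - card H) - e * n - c)" using Y2 t by (intro mult_left_mono)
  then have "t * Y \<ge> u * n - u * card H - t * (e * n) - t * c"
    by (simp add: right_diff_distrib mult.assoc[symmetric] t(2))
  moreover have "t * card P + t * card (X - P) = t * card X"
    using P finP fin card_mono[of X P] by (simp add: card_Diff_subset of_nat_diff algebra_simps)
  moreover have "t * card X \<ge> t * (a * (real n - M) - c)"
    using lower[of "n - M"] n t unfolding X_def by (intro mult_left_mono) (auto simp: of_nat_diff)
  then have "t * card X \<ge> u * n - u * M - t * c"
    by (simp add: right_diff_distrib mult.assoc[symmetric] t(2))
  ultimately have "(1 + t) * card ?C \<ge> 2 * (u * n) - u * M - t * (e * n) - 2 * (t * c)"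
    using P(2) hull Y1 by linarith
  then show ?thesis by (simp add: t_def algebra_simps)
qed

section \<open>Record lengths, and densities as limits of counts\<close>

text \<open>At a maximum \<open>M\<close> of the surplus \<open>f\<close> on an initial segment,
  \<open>f s \<le> f M\<close> is the bound on every tail. Since the ratio exceeds
  \<open>v > u\<close> infinitely often, \<open>f\<close> is unbounded and the maximum can be forced
  past \<open>m\<close>.\<close>

lemma exists_record_length:
  fixes C :: "nat set" and u v :: real
  assumes uv: "u < v" and freq: "\<exists>\<^sub>F n in sequentially. v < initial_ratio C n"
  obtains M where "M \<ge> m" and "\<And>s. s \<le> M \<Longrightarrow> u * (real M - real s) \<le> card (C \<inter> {s..<M})"
proof -
  define f where "f n = card (C \<inter> {0..<n}) - u * n" for n
  define B where "B = Max (f ` {0..m})"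
  have B: "f s \<le> B" if "s \<le> m" for s using that by (auto simp: B_def)
  obtain k :: nat where k: "real k > B / (v - u)" using reals_Archimedean2 by blast
  \<comment> \<open>Beyond \<open>k\<close> the surplus at \<open>n\<close> is more than
    \<open>(v - u) * n\<close>, hence more than \<open>B\<close>; \<open>Suc\<close> also makes
    \<open>n\<close> positive.\<close>
  obtain n where n: "n \<ge> Suc (max k m)" "v < initial_ratio C n"
    using freq unfolding frequently_sequentially by blast
  have "v * n < card (C \<inter> {0..<n})" using n by (simp add: initial_ratio_def field_simps)
  then have "(v - u) * n < f n" by (simp add: f_def algebra_simps)
  moreover have "B < (v - u) * k" using k uv by (simp add: field_simps)
  moreover have "(v - u) * k \<le> (v - u) * n" using uv n by (intro mult_left_mono) auto
  ultimately have Bn: "B < f n" by linarith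
  have "Max (f ` {0..n}) \<in> f ` {0..n}" by (rule Max_in) auto
  then obtain M where M: "Max (f ` {0..n}) = f M" "M \<in> {0..n}" by (rule imageE)
  have max: "f s \<le> f M" if "s \<le> n" for s
    unfolding M(1)[symmetric] using that by (intro Max_ge) auto
  have "M \<ge> m"
  proof (rule ccontr)
    assume "\<not> M \<ge> m"
    then show False using B[of M] Bn max[of n] by auto
  qed
  moreover have "u * (real M - real s) \<le> card (C \<inter> {s..<M})" if "s \<le> M" for s
  proof -
    have "C \<inter> {0..<M} = (C \<inter> {0..<s}) \<union> (C \<inter> {s..<M})" using that by auto
    then have "card (C \<inter> {0..<M}) = card (C \<inter> {0..<s}) + card (C \<inter> {s..<M})"
      by (simp only:) (subst card_Un_disjoint; auto)
    moreover have "f s \<le> f M" using max[of s] that M by simp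
    ultimately show ?thesis by (simp add: f_def algebra_simps)
  qed
  ultimately show thesis using that by blast
qed

lemma frequently_upper_density:
  assumes "v < upper_density C"
  shows "\<exists>\<^sub>F n in sequentially. v < initial_ratio C n"
proof (rule ccontr)
  assume "\<not> ?thesis"
  then have "eventually (\<lambda>n. ereal (initial_ratio C n) \<le> ereal v) sequentially"
    by (simp add: not_frequently not_less)
  then have "ereal (upper_density C) \<le> ereal v"
    unfolding ereal_upper_density by (rule Limsup_bounded)
  with assms show False by simp
qed

lemma lower_density_geI:
  assumes lim: "h \<longlonglongrightarrow> x" and le: "eventually (\<lambda>n. h n \<le> initial_ratio C n) sequentially"
  shows "x \<le> lower_density C"
proof -
  have "ereal x = liminf (\<lambda>n. ereal (h n))"
    by (rule lim_imp_Liminf[symmetric]) (use lim in auto)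
  also have "\<dots> \<le> liminf (\<lambda>n. ereal (initial_ratio C n))"
    by (rule Liminf_mono) (use le in \<open>auto elim: eventually_mono\<close>)
  finally show ?thesis by (simp add: ereal_lower_density[symmetric])
qed

lemma lower_le_upper_density: "lower_density C \<le> upper_density C"
proof -
  have "ereal (lower_density C) \<le> ereal (upper_density C)"
    unfolding ereal_lower_density ereal_upper_density by (rule Liminf_le_Limsup) simp
  then show ?thesis by simp
qed

lemma tendsto_initial_ratio:
  assumes "admits_density A"
  shows "initial_ratio A \<longlonglongrightarrow> asymptotic_density A"
proof -
  have "((\<lambda>n. ereal (initial_ratio A n)) \<longlongrightarrow> ereal (asymptotic_density A)) sequentially"
    using assms by (intro Liminf_eq_Limsup)
      (simp_all add: ereal_lower_density[symmetric] ereal_upper_density[symmetric]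
        asymptotic_density_def admits_density_def)
  then show ?thesis by simp
qed

text \<open>The translate \<open>b + A\<close> lies in \<open>A + A\<close>, and the shift pushes at
  most \<open>b\<close> elements past \<open>n\<close>.\<close>

lemma card_sumset_initial_ge:
  fixes A :: "nat set"
  assumes "b \<in> A"
  shows "real (card (A \<inter> {0..<n})) - b \<le> card ((A + A) \<inter> {0..<n})"
proof -
  have "A \<inter> {0..<n} \<subseteq> (A \<inter> {0..<n - b}) \<union> {n - b..<n}" by auto
  then have "card (A \<inter> {0..<n}) \<le> card ((A \<inter> {0..<n - b}) \<union> {n - b..<n})"
    by (intro card_mono) auto
  also have "\<dots> \<le> card (A \<inter> {0..<n - b}) + card {n - b..<n}" by (rule card_Un_le)
  also have "card {n - b..<n} \<le> b" by simp
  also have "card (A \<inter> {0..<n - b}) = card ((+) b ` (A \<inter> {0..<n - b}))"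
    by (simp add: card_image)
  also have "\<dots> \<le> card ((A + A) \<inter> {0..<n})"
    using assms by (intro card_mono) auto
  finally show ?thesis by simp
qed

lemma card_initial_ge:
  assumes lim: "initial_ratio A \<longlonglongrightarrow> a" and "a' < a" "0 \<le> a'"
  obtains c :: real where "\<And>n. a' * n - c \<le> card (A \<inter> {0..<n})"
proof -
  have "eventually (\<lambda>n. a' < initial_ratio A n) sequentially"
    using lim assms(2) by (rule order_tendstoD)
  then obtain N where N: "\<And>n. n \<ge> N \<Longrightarrow> a' < initial_ratio A n"
    by (auto simp: eventually_sequentially)
  have "a' * n - a' * N \<le> card (A \<inter> {0..<n})" for n
  proof (cases "n \<ge> N \<and> n > 0")
    case True
    then have "a' * n \<le> card (A \<inter> {0..<n})"
      using N[of n] by (simp add: initial_ratio_def field_simps)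
    moreover have "0 \<le> a' * N" using assms by simp
    ultimately show ?thesis by linarith
  next
    case False
    then have "a' * n \<le> a' * N" using assms by (intro mult_left_mono) auto
    then show ?thesis by (simp add: order_trans[of _ 0])
  qed
  then show thesis using that by blast
qed

text \<open>Subtract the count below \<open>M\<close> from the count below \<open>M + g\<close>. The
  two densities \<open>a + e\<close> and \<open>a - e\<close> differ only on the part of length
  \<open>M\<close>.\<close>

lemma card_window_ge:
  assumes lim: "initial_ratio A \<longlonglongrightarrow> a" and "e > 0"
  obtains N where
    "\<And>M g. M \<ge> N \<Longrightarrow> (a - e) * g - 2 * e * M \<le> real (card (A \<inter> {M..<M + g}))"
proof -
  have "eventually (\<lambda>n. a - e < initial_ratio A n) sequentially"
    "eventually (\<lambda>n. initial_ratio A n < a + e) sequentially"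
    using lim assms(2) by (auto intro: order_tendstoD)
  then have "eventually (\<lambda>n. a - e < initial_ratio A n \<and> initial_ratio A n < a + e) sequentially"
    by eventually_elim simp
  then obtain N where N: "\<And>n. n \<ge> N \<Longrightarrow> a - e < initial_ratio A n \<and> initial_ratio A n < a + e"
    by (auto simp: eventually_sequentially)
  \<comment> \<open>\<open>Suc N\<close> excludes \<open>M = 0\<close>, where the ratio is the
    default \<open>0 / 0 = 0\<close>.\<close>
  have "(a - e) * g - 2 * e * M \<le> real (card (A \<inter> {M..<M + g}))" if M: "M \<ge> Suc N" for M g
  proof -
    have "(a - e) * (M + g) \<le> card (A \<inter> {0..<M + g})"
      using N[of "M + g"] M by (simp add: initial_ratio_def field_simps)
    moreover have "card (A \<inter> {0..<M}) \<le> (a + e) * M"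
      using N[of M] M by (simp add: initial_ratio_def field_simps)
    moreover have "A \<inter> {0..<M + g} = (A \<inter> {0..<M}) \<union> (A \<inter> {M..<M + g})" by auto
    then have "card (A \<inter> {0..<M + g}) = card (A \<inter> {0..<M}) + card (A \<inter> {M..<M + g})"
      by (simp only:) (subst card_Un_disjoint; auto)
    ultimately show ?thesis by (simp add: algebra_simps)
  qed
  then show thesis using that by blast
qed

lemma nonempty_if_pos_density:
  assumes lim: "initial_ratio A \<longlonglongrightarrow> a" and "a > 0"
  shows "A \<noteq> {}"
proof
  assume "A = {}"
  then have "initial_ratio A \<longlonglongrightarrow> 0" by (simp add: initial_ratio_def[abs_def])
  then show False using LIMSEQ_unique[OF lim] assms(2) by fastforce
qed

section \<open>Passage to the limit, first in \<open>n\<close>, then in \<open>e\<close>\<close>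

text \<open>\<open>M\<close> is fixed before \<open>n\<close> grows, so division by \<open>n\<close>
  removes every error term of \<open>card_sumset_lower_bound\<close> except the one from
  \<open>2 * e * n\<close>.\<close>

lemma lower_density_sumset_approx:
  fixes A :: "nat set" and a e u :: real
  assumes lim: "initial_ratio A \<longlonglongrightarrow> a" and e: "0 < e" "e < a"
    and u: "0 \<le> u" "u < upper_density (A + A)"
  shows "(2 * u - 2 * e * (u / (a - e))) / (1 + u / (a - e)) \<le> lower_density (A + A)"
proof -
  define d where "d = a - e"
  have d: "d > 0" "d < a" using e by (auto simp: d_def)
  obtain v where v: "u < v" "v < upper_density (A + A)" using u dense by blast
  obtain c where c: "\<And>n. d * n - c \<le> card (A \<inter> {0..<n})"
    using card_initial_ge[OF lim, of d] d by auto
  obtain N where N: "\<And>M g. M \<ge> N \<Longrightarrow> d * g - 2 * e * M \<le> real (card (A \<inter> {M..<M + g}))"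
    using card_window_ge[OF lim e(1)] unfolding d_def by blast
  obtain b where b: "b \<in> A" using nonempty_if_pos_density[OF lim] e by auto
  obtain M where M: "M \<ge> max (Suc b) N"
    and tail: "\<And>s. s \<le> M \<Longrightarrow> u * (real M - real s) \<le> card ((A + A) \<inter> {s..<M})"
    using exists_record_length[OF v(1) frequently_upper_density[OF v(2)], of "max (Suc b) N"] by blast
  define k where "k = c + b"
  have bnd: "(1 + u / d) * card ((A + A) \<inter> {0..<n}) \<ge> 2 * u * n - u * M - u / d * (2 * e * n + 2 * k)"
    if "n \<ge> M" for n
  proof (rule card_sumset_lower_bound)
    show "A \<inter> {0..<M} \<noteq> {}" using b M by auto
    show "d * real n - k \<le> card (A \<inter> {0..<n})" for n using c[of n] by (simp add: k_def)
    show "d * real n - k \<le> card ((A + A) \<inter> {0..<n})" for n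
      using c[of n] card_sumset_initial_ge[OF b, of n] by (simp add: k_def)
    show "d * real g - 2 * e * M \<le> card (A \<inter> {M..<M + g})" for g using N[of M g] M by auto
  qed (use d e u tail that in auto)
  define L where "L = u * M + u / d * (2 * k)"
  define h where "h n = (2 * u - 2 * e * (u / d)) / (1 + u / d) - L / (1 + u / d) * (1 / n)" for n :: nat
  have pos: "1 + u / d > 0" using u d by (simp add: add_pos_nonneg)
  have "h \<longlonglongrightarrow> (2 * u - 2 * e * (u / d)) / (1 + u / d) - L / (1 + u / d) * 0"
    unfolding h_def by (intro tendsto_diff tendsto_mult tendsto_const lim_1_over_n)
  moreover have "eventually (\<lambda>n. h n \<le> initial_ratio (A + A) n) sequentially"
    using eventually_ge_at_top[of "Suc M"]
  proof eventually_elim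
    case (elim n)
    have "h n * n = ((2 * u - 2 * e * (u / d)) * n - L) / (1 + u / d)"
      using elim by (simp add: h_def diff_divide_distrib left_diff_distrib)
    also have "\<dots> \<le> card ((A + A) \<inter> {0..<n})"
    proof -
      have "(2 * u - 2 * e * (u / d)) * n - L \<le> (1 + u / d) * card ((A + A) \<inter> {0..<n})"
        using bnd[of n] elim by (simp add: L_def algebra_simps)
      then show ?thesis using pos by (simp add: pos_divide_le_eq mult.commute)
    qed
    finally show ?case using elim by (simp add: initial_ratio_def pos_le_divide_eq)
  qed
  ultimately show ?thesis unfolding d_def[symmetric] by (intro lower_density_geI[of h]) auto
qed

lemma density_le_lower_density_sumset:
  assumes lim: "initial_ratio A \<longlonglongrightarrow> a" and "a > 0"
  shows "a \<le> lower_density (A + A)"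
proof -
  obtain b where b: "b \<in> A" using nonempty_if_pos_density[OF lim] assms by auto
  have "(\<lambda>n. initial_ratio A n - real b * (1 / real n)) \<longlonglongrightarrow> a - real b * 0"
    by (intro tendsto_diff lim tendsto_mult tendsto_const lim_1_over_n)
  moreover have "initial_ratio A n - real b * (1 / real n) \<le> initial_ratio (A + A) n" for n
    using card_sumset_initial_ge[OF b, of n]
    by (simp add: initial_ratio_def diff_divide_distrib[symmetric] divide_right_mono)
  ultimately show ?thesis by (intro lower_density_geI) auto
qed

text \<open>Let \<open>e\<close> tend to 0 in \<open>lower_density_sumset_approx\<close>, with
  \<open>u - e\<close> as its \<open>u\<close>: this is strictly below the upper density, and
  nonnegative because \<open>e < a \<le> u\<close>.\<close>

theorem lower_density_sumset_harmonic:
  fixes A :: "nat set"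
  assumes lim: "initial_ratio A \<longlonglongrightarrow> a" and a: "a > 0"
  defines "u \<equiv> upper_density (A + A)"
  shows "2 * a * u / (a + u) \<le> lower_density (A + A)"
proof -
  have u: "u \<ge> a"
    using density_le_lower_density_sumset[OF lim a] lower_le_upper_density[of "A + A"]
    by (simp add: u_def)
  let ?g = "\<lambda>e. (2 * (u - e) - 2 * e * ((u - e) / (a - e))) / (1 + (u - e) / (a - e))"
  have "(?g \<longlongrightarrow> (2 * (u - 0) - 2 * 0 * ((u - 0) / (a - 0))) / (1 + (u - 0) / (a - 0))) (at_right 0)"
    using a u by (intro tendsto_intros) (auto simp: add_nonneg_eq_0_iff)
  moreover have "(2 * (u - 0) - 2 * 0 * ((u - 0) / (a - 0))) / (1 + (u - 0) / (a - 0)) = 2 * a * u / (a + u)"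
    using a u by (simp add: field_simps)
  moreover have "eventually (\<lambda>e. ?g e \<le> lower_density (A + A)) (at_right 0)"
    using eventually_at_right_real[OF a]
  proof eventually_elim
    case (elim e)
    then show ?case using u lower_density_sumset_approx[OF lim, of e "u - e"] by (auto simp: u_def)
  qed
  ultimately show ?thesis by (intro tendsto_upperbound[of ?g _ "at_right 0"]) auto
qed

section \<open>Comparison of power means\<close>

text \<open>With \<open>X = 1 / x\<close>, \<open>Y = 1 / y\<close>, \<open>r = - q\<close>, the two
  means are reciprocals of the \<open>r\<close>-mean and the arithmetic mean of \<open>X\<close> and
  \<open>Y\<close>. For \<open>r \<ge> 1\<close> convexity compares them. For \<open>r < 1\<close>
  the sums satisfy \<open>X + Y \<le> S powr (1 / r)\<close>, and \<open>2 powr (1 + 1 / q)\<close>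
  converts sums into means.\<close>

lemma c_const_q_mean_le_harmonic:
  fixes x y q :: real
  assumes "x > 0" "y > 0" "q < 0"
  shows "c_const q * q_mean q x y \<le> 2 * x * y / (x + y)"
proof -
  define r where "r = - q"
  define X where "X = 1 / x"
  define Y where "Y = 1 / y"
  have pos: "r > 0" "X > 0" "Y > 0" using assms by (auto simp: r_def X_def Y_def)
  have q: "x powr q = X powr r" "y powr q = Y powr r" "1 / q = - (1 / r)"
    using assms by (auto simp: r_def X_def Y_def powr_minus powr_divide field_simps)
  have hm: "2 * x * y / (x + y) = 1 / ((X + Y) / 2)"
    using assms by (simp add: X_def Y_def field_simps)
  define S where "S = X powr r + Y powr r"
  have S: "S > 0" using pos by (simp add: S_def add_pos_pos)
  have mean: "q_mean q x y = 1 / ((S / 2) powr (1 / r))"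
    by (simp add: q_mean_def q S_def powr_minus field_simps)
  show ?thesis
  proof (cases "r \<ge> 1")
    case True
    have "((X + Y) / 2) powr r \<le> S / 2"
      using convex_onD[OF powr_convex[OF True], of "1/2" X Y] pos
      by (simp add: S_def add_divide_distrib)
    then have "(((X + Y) / 2) powr r) powr (1 / r) \<le> (S / 2) powr (1 / r)"
      using pos by (intro powr_mono2) auto
    then have "(X + Y) / 2 \<le> (S / 2) powr (1 / r)"
      using pos by (simp add: powr_powr)
    then have "q_mean q x y \<le> 2 * x * y / (x + y)"
      unfolding mean hm using pos S by (intro divide_left_mono mult_pos_pos) auto
    moreover have "c_const q * q_mean q x y \<le> 1 * q_mean q x y"
      by (intro mult_right_mono) (auto simp: c_const_def q_mean_def)
    ultimately show ?thesis by simp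
  next
    case False
    \<comment> \<open>After scaling to sum 1 each share is at most 1, so an exponent
      \<open>r < 1\<close> does not decrease it.\<close>
    have "z / (X + Y) \<le> (z / (X + Y)) powr r" if "z = X \<or> z = Y" for z
      using powr_mono'[of r 1 "z / (X + Y)"] False pos that by auto
    then have "X / (X + Y) + Y / (X + Y) \<le> (X / (X + Y)) powr r + (Y / (X + Y)) powr r"
      by (simp add: add_mono)
    also have "\<dots> = S / (X + Y) powr r"
      using pos by (simp add: S_def powr_divide add_divide_distrib)
    finally have "(X + Y) powr r \<le> S"
      using pos by (simp add: add_divide_distrib[symmetric] pos_le_divide_eq)
    then have "((X + Y) powr r) powr (1 / r) \<le> S powr (1 / r)"
      using pos by (intro powr_mono2) auto
    then have le: "X + Y \<le> S powr (1 / r)" using pos by (simp add: powr_powr)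
    have "c_const q * q_mean q x y \<le> 2 powr (1 + 1 / q) * q_mean q x y"
      by (intro mult_right_mono) (auto simp: c_const_def q_mean_def)
    also have "\<dots> = 2 / S powr (1 / r)"
      unfolding mean using S by (simp add: q powr_diff powr_divide)
    also have "\<dots> \<le> 2 / (X + Y)" using le pos S by (intro divide_left_mono mult_pos_pos) auto
    finally show ?thesis unfolding hm by simp
  qed
qed

theorem proposition1p4:
  fixes q :: real and A :: "nat set"
  assumes "q < 0"
    and "admits_density A"
    and "asymptotic_density A > 0"
  shows "lower_density (A + A) \<ge> c_const q * q_mean q (asymptotic_density A) (upper_density (A + A))"
proof -
  note lim = tendsto_initial_ratio[OF assms(2)]
  have "upper_density (A + A) > 0"
    using density_le_lower_density_sumset[OF lim assms(3)] lower_le_upper_density[of "A + A"] assms(3)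
    by linarith
  then show ?thesis
    using c_const_q_mean_le_harmonic[OF assms(3) _ assms(1)]
      lower_density_sumset_harmonic[OF lim assms(3)] order_trans by blast
qed

end
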